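(* For $\beta\in\mathbb{R}$ let $Q_\beta(X)=X^3+(1-\beta)X^2-(2+\beta)X-1$. Let $\beta,\gamma\in\mathbb{R}$. (i) All roots of $Q_\beta$ are real, and, denoting them in increasing order by $q^{\langle\beta\rangle}_1,q^{\langle\beta\rangle}_2,q^{\langle\beta\rangle}_3$, they satisfy $q^{\langle\beta\rangle}_1<-1<q^{\langle\beta\rangle}_2<0<q^{\langle\beta\rangle}_3$. (ii) If $q$ is a root of $Q_\beta$, then the other two roots are $-\frac1q-1$ and $-\frac{1}{q+1}$. (iii) If $\beta<\gamma$, then $q^{\langle\beta\rangle}_1<q^{\langle\gamma\rangle}_1<-1<q^{\langle\beta\rangle}_2<q^{\langle\gamma\rangle}_2<0<q^{\langle\beta\rangle}_3<q^{\langle\gamma\rangle}_3$. *)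

theory Defs
  imports Complex_Main "HOL-Computational_Algebra.Polynomial"
begin

definition Q :: "real \<Rightarrow> real poly" where
  "Q \<beta> = monom 1 3 + monom (1 - \<beta>) 2 - monom (2 + \<beta>) 1 - 1"

(* The i-th smallest real root of Q \<beta>, counted with multiplicity; the index i starts at 1.
   The value is meaningful only for 1 \<le> i \<le> size (proots (Q \<beta>)). *)
definition q_root :: "real \<Rightarrow> nat \<Rightarrow> real" where
  "q_root \<beta> i = sorted_list_of_multiset (proots (Q \<beta>)) ! (i - 1)"

end

theory Submission
  imports Defs
begin

text \<open>
  If \<open>q\<close> is a root of \<open>Q \<beta> = X\<^sup>3 + X\<^sup>2 - 2 X - 1 - \<beta> X (X + 1)\<close>, eliminating \<open>\<beta>\<close> gives
  \<open>Q \<beta> = (X - q) (X + 1 / q + 1) (X + 1 / (q + 1))\<close>. By the intermediate value theorem there is a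
  root \<open>q > 0\<close>, and then the other two lie in the right intervals and are increasing functions
  of \<open>q\<close>. So monotonicity only has to be checked for the positive root \<open>q\<close> of \<open>Q \<gamma>\<close>: the positive
  root \<open>p\<close> of \<open>Q \<beta>\<close> satisfies \<open>poly (Q \<gamma>) p = (\<beta> - \<gamma>) p (p + 1) < 0\<close>, hence \<open>p < q\<close>.
\<close>

lemma poly_Q: "poly (Q \<beta>) x = x ^ 3 + x ^ 2 - 2 * x - 1 - \<beta> * x * (x + 1)"
  by (simp add: Q_def poly_monom algebra_simps power2_eq_square)

lemma Q_pCons: "Q \<beta> = [:-1, - (2 + \<beta>), 1 - \<beta>, 1:]"
  by (simp add: Q_def monom_altdef numeral_eq_Suc one_pCons)

text \<open>The term in \<open>\<beta>\<close> vanishes at 0 and -1, so there the polynomial takes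
  the values -1 and 1 for every \<open>\<beta>\<close>. This justifies dividing by \<open>q\<close>
  and \<open>q + 1\<close> later.\<close>

lemma Q_root_neq:
  assumes "poly (Q \<beta>) q = 0"
  shows "q \<noteq> 0" "q + 1 \<noteq> 0"
proof -
  show "q \<noteq> 0" using assms by (auto simp: poly_Q)
  have "q \<noteq> - 1" using assms by (auto simp: poly_Q)
  then show "q + 1 \<noteq> 0" by (simp add: add_eq_0_iff2)
qed

lemma Q_factor:
  assumes "poly (Q \<beta>) q = 0"
  shows "Q \<beta> = [:- q, 1:] * [:- (- (1 / q) - 1), 1:] * [:- (- (1 / (q + 1))), 1:]"
proof -
  note nz = Q_root_neq[OF assms]
  have "\<beta> * (q * (q + 1)) = q ^ 3 + q ^ 2 - 2 * q - 1"
    using assms by (simp add: poly_Q)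
  then have \<beta>: "\<beta> = (q ^ 3 + q ^ 2 - 2 * q - 1) / (q * (q + 1))"
    using nz by (simp add: eq_divide_eq)
  \<comment> \<open>With \<open>\<beta>\<close> substituted, comparing coefficients leaves only
    rational identities in \<open>q\<close>.\<close>
  show ?thesis
    unfolding Q_pCons \<beta> using nz
    by (simp add: divide_simps) (simp add: algebra_simps power2_eq_square power3_eq_cube)
qed

lemma proots_Q:
  assumes "poly (Q \<beta>) q = 0"
  shows "proots (Q \<beta>) = {#q, - (1 / q) - 1, - (1 / (q + 1))#}"
proof -
  have "proots ([:- a, 1:] * [:- b, 1:] * [:- c, 1:]) = {#a, b, c#}" for a b c :: real
    \<comment> \<open>The product must stay unexpanded for \<open>proots_mult\<close> to
      apply.\<close>
    by (simp add: proots_mult del: mult_pCons_left mult_pCons_right)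
  then show ?thesis
    unfolding Q_factor[OF assms] .
qed

text \<open>The splitting into real linear factors persists over the complex numbers, which have no
  zero divisors.\<close>

lemma complex_root_Q_real:
  assumes q: "poly (Q \<beta>) q = 0"
    and z: "poly (map_poly complex_of_real (Q \<beta>)) z = 0"
  shows "z \<in> \<real>"
proof -
  have "poly (map_poly complex_of_real ([:- a, 1:] * [:- b, 1:] * [:- c, 1:])) z =
      (z - of_real a) * (z - of_real b) * (z - of_real c)" for a b c
    by (simp add: map_poly_pCons algebra_simps)
  then have "(z - of_real q) * (z - of_real (- (1 / q) - 1)) * (z - of_real (- (1 / (q + 1)))) = 0"
    using z unfolding Q_factor[OF q] by metis
  then have "z = of_real q \<or> z = of_real (- (1 / q) - 1) \<or> z = of_real (- (1 / (q + 1)))"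
    by (simp only: mult_eq_0_iff right_minus_eq disj_assoc)
  then show ?thesis
    by (metis Reals_of_real)
qed

lemma Q_positive_root: "\<exists>q>0. poly (Q \<beta>) q = 0"
proof -
  \<comment> \<open>Chosen so that \<open>\<beta> \<le> M - 2\<close> and \<open>M \<ge> 2\<close>;
    then the value at \<open>M\<close> is at least \<open>2 * M^2 - 1 > 0\<close>.\<close>
  define M where "M = \<bar>\<beta>\<bar> + 2"
  have M: "M \<ge> 2" "\<beta> \<le> M - 2" by (auto simp: M_def)
  have "\<beta> * (M * (M + 1)) \<le> (M - 2) * (M * (M + 1))"
    using M by (intro mult_right_mono) auto
  moreover have "M * M \<ge> 2 * 2" using M by (intro mult_mono) auto
  ultimately have "poly (Q \<beta>) M > 0"
    by (simp add: poly_Q algebra_simps power2_eq_square power3_eq_cube)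
  moreover have "poly (Q \<beta>) 0 < 0" by (simp add: poly_Q)
  ultimately show ?thesis using poly_IVT_pos[of 0 M "Q \<beta>"] M by auto
qed

lemma q_root_eq:
  assumes "poly (Q \<beta>) q = 0" "q > 0"
  shows "q_root \<beta> 1 = - (1 / q) - 1" "q_root \<beta> 2 = - (1 / (q + 1))" "q_root \<beta> 3 = q"
proof -
  \<comment> \<open>These bounds place one root below -1 and another between -1 and 0, which fixes
    the order.\<close>
  have "1 / q > 0" "1 / (q + 1) > 0" "1 / (q + 1) < 1"
    using assms(2) by auto
  then have order: "- (1 / q) - 1 \<le> - (1 / (q + 1))" "- (1 / (q + 1)) \<le> q"
    using assms(2) by linarith+
  have "proots (Q \<beta>) = mset [- (1 / q) - 1, - (1 / (q + 1)), q]"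
    using proots_Q[OF assms(1)] by simp
  then have "sorted_list_of_multiset (proots (Q \<beta>)) = sort [- (1 / q) - 1, - (1 / (q + 1)), q]"
    by (simp only: sorted_list_of_multiset_mset)
  also have "\<dots> = [- (1 / q) - 1, - (1 / (q + 1)), q]"
    using order by (intro sorted_sort_id) auto
  finally show "q_root \<beta> 1 = - (1 / q) - 1" "q_root \<beta> 2 = - (1 / (q + 1))" "q_root \<beta> 3 = q"
    by (simp_all add: q_root_def)
qed

lemma Q_positive_root_mono:
  assumes p: "poly (Q \<beta>) p = 0" "p > 0" and q: "poly (Q \<gamma>) q = 0" "q > 0" and "\<beta> < \<gamma>"
  shows "p < q"
proof -
  \<comment> \<open>The other two roots of \<open>Q \<gamma>\<close> are negative, so their factors
    are positive at \<open>p\<close> and the sign of the value is that of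
    \<open>p - q\<close>.\<close>
  have "poly (Q \<gamma>) p = (p - q) * ((p + (1 / q + 1)) * (p + 1 / (q + 1)))"
    unfolding Q_factor[OF q(1)] poly_mult by (simp add: mult.assoc add.commute)
  \<comment> \<open>This is the difference of the two polynomials at \<open>p\<close>, where
    \<open>Q \<beta>\<close> vanishes.\<close>
  moreover have "poly (Q \<gamma>) p = (\<beta> - \<gamma>) * (p * (p + 1))"
    using p(1) by (simp add: poly_Q algebra_simps)
  moreover have "(\<beta> - \<gamma>) * (p * (p + 1)) < 0"
    using p(2) \<open>\<beta> < \<gamma>\<close> by (intro mult_neg_pos) auto
  ultimately have "(p - q) * ((p + (1 / q + 1)) * (p + 1 / (q + 1))) < 0"
    by simp
  moreover have "(p + (1 / q + 1)) * (p + 1 / (q + 1)) > 0"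
    using p(2) q(2) by (intro mult_pos_pos add_pos_pos) auto
  ultimately show ?thesis
    by (metis diff_less_0_iff_less mult_less_0_iff less_asym)
qed

theorem lemmaA1:
  fixes \<beta> \<gamma> :: real
  shows
    "((\<forall>z::complex. poly (map_poly complex_of_real (Q \<beta>)) z = 0 \<longrightarrow> z \<in> \<real>) \<and>
      proots (Q \<beta>) = {#q_root \<beta> 1, q_root \<beta> 2, q_root \<beta> 3#} \<and>
      q_root \<beta> 1 < -1 \<and> -1 < q_root \<beta> 2 \<and> q_root \<beta> 2 < 0 \<and> 0 < q_root \<beta> 3) \<and>
     (\<forall>q::real. poly (Q \<beta>) q = 0 \<longrightarrow>
        q \<noteq> 0 \<and> q + 1 \<noteq> 0 \<and>
        proots (Q \<beta>) = {#q, - (1 / q) - 1, - (1 / (q + 1))#}) \<and>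
     (\<beta> < \<gamma> \<longrightarrow>
        q_root \<beta> 1 < q_root \<gamma> 1 \<and> q_root \<gamma> 1 < -1 \<and>
        -1 < q_root \<beta> 2 \<and> q_root \<beta> 2 < q_root \<gamma> 2 \<and> q_root \<gamma> 2 < 0 \<and>
        0 < q_root \<beta> 3 \<and> q_root \<beta> 3 < q_root \<gamma> 3)"
proof -
  obtain p where p: "p > 0" "poly (Q \<beta>) p = 0" using Q_positive_root by blast
  obtain q where q: "q > 0" "poly (Q \<gamma>) q = 0" using Q_positive_root by blast
  note roots = q_root_eq[OF p(2,1)] q_root_eq[OF q(2,1)]
  have real: "\<forall>z::complex. poly (map_poly complex_of_real (Q \<beta>)) z = 0 \<longrightarrow> z \<in> \<real>"
    using complex_root_Q_real[OF p(2)] by blast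
  have proots: "proots (Q \<beta>) = {#q_root \<beta> 1, q_root \<beta> 2, q_root \<beta> 3#}"
    unfolding roots proots_Q[OF p(2)] by simp
  have intervals: "q_root \<beta> 1 < -1" "-1 < q_root \<beta> 2" "q_root \<beta> 2 < 0" "0 < q_root \<beta> 3"
    "q_root \<gamma> 1 < -1" "q_root \<gamma> 2 < 0"
    unfolding roots using p(1) q(1) by auto
  have mono: "q_root \<beta> 1 < q_root \<gamma> 1 \<and> q_root \<beta> 2 < q_root \<gamma> 2 \<and> q_root \<beta> 3 < q_root \<gamma> 3"
    if "\<beta> < \<gamma>"
  proof -
    have "p < q" using Q_positive_root_mono p q that by blast
    then show ?thesis
      unfolding roots using p(1) by (auto intro!: divide_strict_left_mono)
  qed
  show ?thesis
    using real proots intervals mono Q_root_neq proots_Q by blast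
qed

end
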